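(* There exists a Banach lattice $E$ such that for every $\varepsilon>0$ there exists a contraction $T\in B(E)$ which is $\varepsilon$-band preserving (actually, $T$ belongs to the $\varepsilon$-center $\varepsilon\text{-}\mathcal{Z}(E)$) and satisfies $\|T-S\|\ge 1/2$ for every band preserving operator $S\in B(E)$.
   Context: $B(E)$ denotes the space of bounded linear operators on $E$. A band in a Banach lattice $X$ is an (order) ideal $Y\subset X$ which contains $\bigvee_\alpha y_\alpha$ for every family $(y_\alpha)$ in $Y$ whose supremum exists in $X$. A linear operator $T:X\to X$ is band preserving (BP) if $T(Y)\subset Y$ for every band $Y\subset X$. A linear map $T:X\to X$ is $\varepsilon$-band preserving ($\varepsilon$-BP) if for every $x\in X$, $\sup\{\||Tx|\wedge y\| : y\ge 0,\ y\perp x\}\le\varepsilon\|x\|$. An operator $T:X\to X$ is in the $\varepsilon$-center, written $T\in\varepsilon\text{-}\mathcal{Z}(X)$, if there exists $\lambda>0$ such that for every $x\in X$ with $\|x\|\le 1$ there is $z\in X$ with $\|z\|\le\varepsilon$ and $|Tx|\le\lambda|x|+z$. *)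

theory Defs
  imports "HOL-Analysis.Analysis" "HOL-Algebra.Algebraic_Closure_Type"
begin

text \<open>
  Real Banach lattices are represented with an explicit carrier, so that ``there exists a Banach
  lattice'' can be expressed by an existential quantifier over records. As usual for \<open>module\<close>
  records, the ring fields \<open>mult\<close> and \<open>one\<close> carry no meaning.
\<close>

record 'a normed_riesz = "(real, 'a) module" +
  vle :: "'a \<Rightarrow> 'a \<Rightarrow> bool"  (infixl \<open>\<preceq>\<index>\<close> 50)
  vnorm :: "'a \<Rightarrow> real"

abbreviation real_ring :: "real ring" where
  "real_ring \<equiv> ring_of_type_algebra"

definition order_of :: "('a, 'm) normed_riesz_scheme \<Rightarrow> 'a gorder" where
  "order_of E = \<lparr>carrier = carrier E, eq = (=), le = vle E\<rparr>"

definition vsup :: "('a, 'm) normed_riesz_scheme \<Rightarrow> 'a \<Rightarrow> 'a \<Rightarrow> 'a" where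
  "vsup E x y = x \<squnion>\<^bsub>order_of E\<^esub> y"

definition vinf :: "('a, 'm) normed_riesz_scheme \<Rightarrow> 'a \<Rightarrow> 'a \<Rightarrow> 'a" where
  "vinf E x y = x \<sqinter>\<^bsub>order_of E\<^esub> y"

definition vabs :: "('a, 'm) normed_riesz_scheme \<Rightarrow> 'a \<Rightarrow> 'a" where
  "vabs E x = vsup E x (\<ominus>\<^bsub>E\<^esub> x)"

definition vdisjoint :: "('a, 'm) normed_riesz_scheme \<Rightarrow> 'a \<Rightarrow> 'a \<Rightarrow> bool" where
  "vdisjoint E x y \<longleftrightarrow> vinf E (vabs E x) (vabs E y) = \<zero>\<^bsub>E\<^esub>"

text \<open>The value \<open>0\<close> off the carrier is needed because the axioms of \<open>Metric_space\<close>
  constrain the distance on the whole type.\<close>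

definition vdist :: "('a, 'm) normed_riesz_scheme \<Rightarrow> 'a \<Rightarrow> 'a \<Rightarrow> real" where
  "vdist E x y = (if x \<in> carrier E \<and> y \<in> carrier E then vnorm E (x \<ominus>\<^bsub>E\<^esub> y) else 0)"

locale banach_lattice =
  fixes E :: "('a, 'm) normed_riesz_scheme" (structure)
  assumes vector_space: "module real_ring E"
    and lattice: "Lattice.lattice (order_of E)"
    and add_mono: "\<lbrakk>x \<in> carrier E; y \<in> carrier E; z \<in> carrier E; x \<preceq> y\<rbrakk> \<Longrightarrow> x \<oplus> z \<preceq> y \<oplus> z"
    and smult_mono: "\<lbrakk>x \<in> carrier E; y \<in> carrier E; 0 \<le> a; x \<preceq> y\<rbrakk> \<Longrightarrow> a \<odot> x \<preceq> a \<odot> y"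
    and norm_nonneg: "x \<in> carrier E \<Longrightarrow> 0 \<le> vnorm E x"
    and norm_eq_zero: "x \<in> carrier E \<Longrightarrow> vnorm E x = 0 \<longleftrightarrow> x = \<zero>"
    and norm_smult: "x \<in> carrier E \<Longrightarrow> vnorm E (a \<odot> x) = \<bar>a\<bar> * vnorm E x"
    and norm_triangle:
      "\<lbrakk>x \<in> carrier E; y \<in> carrier E\<rbrakk> \<Longrightarrow> vnorm E (x \<oplus> y) \<le> vnorm E x + vnorm E y"
    and norm_mono:
      "\<lbrakk>x \<in> carrier E; y \<in> carrier E; vabs E x \<preceq> vabs E y\<rbrakk> \<Longrightarrow> vnorm E x \<le> vnorm E y"
    and complete: "Metric_space.mcomplete (carrier E) (vdist E)"

definition order_ideal :: "('a, 'm) normed_riesz_scheme \<Rightarrow> 'a set \<Rightarrow> bool" where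
  "order_ideal E Y \<longleftrightarrow> submodule Y real_ring E \<and>
     (\<forall>x\<in>carrier E. \<forall>y\<in>Y. vabs E x \<preceq>\<^bsub>E\<^esub> vabs E y \<longrightarrow> x \<in> Y)"

definition band :: "('a, 'm) normed_riesz_scheme \<Rightarrow> 'a set \<Rightarrow> bool" where
  "band E Y \<longleftrightarrow> order_ideal E Y \<and> (\<forall>A s. A \<subseteq> Y \<and> is_lub (order_of E) s A \<longrightarrow> s \<in> Y)"

text \<open>Operators are functions on the underlying type; only their values on the carrier matter.\<close>

definition linear_operator :: "('a, 'm) normed_riesz_scheme \<Rightarrow> ('a \<Rightarrow> 'a) \<Rightarrow> bool" where
  "linear_operator E T \<longleftrightarrow> T \<in> carrier E \<rightarrow> carrier E \<and>
     (\<forall>x\<in>carrier E. \<forall>y\<in>carrier E. T (x \<oplus>\<^bsub>E\<^esub> y) = T x \<oplus>\<^bsub>E\<^esub> T y) \<and>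
     (\<forall>a. \<forall>x\<in>carrier E. T (a \<odot>\<^bsub>E\<^esub> x) = a \<odot>\<^bsub>E\<^esub> T x)"

definition bounded_operators :: "('a, 'm) normed_riesz_scheme \<Rightarrow> ('a \<Rightarrow> 'a) set" where
  "bounded_operators E =
     {T. linear_operator E T \<and> (\<exists>C. \<forall>x\<in>carrier E. vnorm E (T x) \<le> C * vnorm E x)}"

definition opnorm :: "('a, 'm) normed_riesz_scheme \<Rightarrow> ('a \<Rightarrow> 'a) \<Rightarrow> real" where
  "opnorm E T = (SUP x \<in> {x \<in> carrier E. vnorm E x \<le> 1}. vnorm E (T x))"

definition op_diff ::
  "('a, 'm) normed_riesz_scheme \<Rightarrow> ('a \<Rightarrow> 'a) \<Rightarrow> ('a \<Rightarrow> 'a) \<Rightarrow> 'a \<Rightarrow> 'a" where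
  "op_diff E T S = (\<lambda>x. T x \<ominus>\<^bsub>E\<^esub> S x)"

definition band_preserving :: "('a, 'm) normed_riesz_scheme \<Rightarrow> ('a \<Rightarrow> 'a) \<Rightarrow> bool" where
  "band_preserving E T \<longleftrightarrow> linear_operator E T \<and> (\<forall>Y. band E Y \<longrightarrow> T ` Y \<subseteq> Y)"

text \<open>In a Banach lattice the supremum below is over a nonempty set (it contains the value at
  \<open>y = 0\<close>) that is bounded above by the norm of \<open>T x\<close>.\<close>

definition eps_band_preserving ::
  "('a, 'm) normed_riesz_scheme \<Rightarrow> real \<Rightarrow> ('a \<Rightarrow> 'a) \<Rightarrow> bool" where
  "eps_band_preserving E \<epsilon> T \<longleftrightarrow> linear_operator E T \<and>
     (\<forall>x\<in>carrier E.
        (SUP y \<in> {y \<in> carrier E. \<zero>\<^bsub>E\<^esub> \<preceq>\<^bsub>E\<^esub> y \<and> vdisjoint E y x}. vnorm E (vinf E (vabs E (T x)) y))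
          \<le> \<epsilon> * vnorm E x)"

definition eps_center :: "('a, 'm) normed_riesz_scheme \<Rightarrow> real \<Rightarrow> ('a \<Rightarrow> 'a) set" where
  "eps_center E \<epsilon> = {T. linear_operator E T \<and>
     (\<exists>c>0. \<forall>x\<in>carrier E. vnorm E x \<le> 1 \<longrightarrow>
        (\<exists>z\<in>carrier E. vnorm E z \<le> \<epsilon> \<and> vabs E (T x) \<preceq>\<^bsub>E\<^esub> c \<odot>\<^bsub>E\<^esub> vabs E x \<oplus>\<^bsub>E\<^esub> z))}"

end

theory Submission
  imports Defs
begin

text \<open>
  Identify \<open>nat\<close> with \<open>nat \<times> nat\<close> and let the lattice consist of the bounded functions \<open>f\<close> with
  \<open>f (n, k) \<longrightarrow> f (n, 0) / (n + 1)\<close> as \<open>k \<longrightarrow> \<infinity>\<close>, for every \<open>n\<close>: a closed sublattice of the bounded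
  functions with the supremum norm, in which the limit along row \<open>n\<close> is at most \<open>\<parallel>f\<parallel> / (n + 1)\<close>
  in absolute value. For \<open>k > 0\<close> put \<open>T f (n, k) = (-1)^k / 2 * (f (n, k) - f (n, 0) / (n + 1))\<close>,
  and \<open>T f = 0\<close> elsewhere. Subtracting the limit makes \<open>T f\<close> converge to \<open>0\<close>, and it only costs
  \<open>1 / (n + 1) \<le> \<epsilon>\<close>. A band preserving \<open>S\<close> acts on the atoms of row \<open>n\<close> by a convergent sequence
  of multipliers, whereas \<open>T\<close> acts on them by \<open>(-1)^k / 2\<close>, which has distance \<open>1/2\<close> from
  every convergent sequence.
\<close>

section \<open>Closed sublattices of the bounded functions\<close>

definition function_lattice :: "('i \<Rightarrow> real) set \<Rightarrow> ('i \<Rightarrow> real) normed_riesz" where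
  "function_lattice A =
     \<lparr>carrier = A, mult = (\<lambda>f g i. f i * g i), one = (\<lambda>i. 1),
      zero = (\<lambda>i. 0), add = (\<lambda>f g i. f i + g i),
      smult = (\<lambda>a f i. a * f i),
      vle = (\<lambda>f g. \<forall>i. f i \<le> g i), vnorm = (\<lambda>f. SUP i. \<bar>f i\<bar>)\<rparr>"

text \<open>Pointwise \<open>max\<close> keeps the lattice operations of \<open>A\<close> pointwise.
  Closure under uniform limits gives completeness for the supremum norm. Closure under negation,
  \<open>min\<close> and absolute value follows.\<close>

locale closed_function_lattice =
  fixes A :: "('i \<Rightarrow> real) set"
  assumes bounded: "f \<in> A \<Longrightarrow> bounded (range f)"
    and zero_mem: "(\<lambda>i. 0) \<in> A"
    and add_mem: "\<lbrakk>f \<in> A; g \<in> A\<rbrakk> \<Longrightarrow> (\<lambda>i. f i + g i) \<in> A"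
    and smult_mem: "f \<in> A \<Longrightarrow> (\<lambda>i. a * f i) \<in> A"
    and max_mem: "\<lbrakk>f \<in> A; g \<in> A\<rbrakk> \<Longrightarrow> (\<lambda>i. max (f i) (g i)) \<in> A"
    and uniform_limit_mem:
      "\<lbrakk>\<And>n. F n \<in> A; uniform_limit UNIV F f sequentially\<rbrakk> \<Longrightarrow> f \<in> A"
begin

abbreviation E :: "('i \<Rightarrow> real) normed_riesz" where
  "E \<equiv> function_lattice A"

lemma structure_simps [simp]:
  "carrier E = A" "\<zero>\<^bsub>E\<^esub> = (\<lambda>i. 0)" "f \<oplus>\<^bsub>E\<^esub> g = (\<lambda>i. f i + g i)"
  "a \<odot>\<^bsub>E\<^esub> f = (\<lambda>i. a * f i)" "f \<preceq>\<^bsub>E\<^esub> g \<longleftrightarrow> (\<forall>i. f i \<le> g i)"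
  by (simp_all add: function_lattice_def)

lemma order_simps [simp]:
  "carrier (order_of E) = A" "f \<sqsubseteq>\<^bsub>order_of E\<^esub> g \<longleftrightarrow> (\<forall>i. f i \<le> g i)"
  "f .=\<^bsub>order_of E\<^esub> g \<longleftrightarrow> f = g"
  by (simp_all add: order_of_def)

lemma uminus_mem: "f \<in> A \<Longrightarrow> (\<lambda>i. - f i) \<in> A"
  using smult_mem[of f "-1"] by simp

lemma diff_mem: "\<lbrakk>f \<in> A; g \<in> A\<rbrakk> \<Longrightarrow> (\<lambda>i. f i - g i) \<in> A"
  using add_mem[OF _ uminus_mem, of f g] by simp

lemma min_mem: "\<lbrakk>f \<in> A; g \<in> A\<rbrakk> \<Longrightarrow> (\<lambda>i. min (f i) (g i)) \<in> A"
  using uminus_mem[OF max_mem[OF uminus_mem uminus_mem], of f g] by (simp add: minus_max_eq_min)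

lemma abs_mem:
  assumes "f \<in> A"
  shows "(\<lambda>i. \<bar>f i\<bar>) \<in> A"
proof -
  have "(\<lambda>i. \<bar>f i\<bar>) = (\<lambda>i. max (f i) (- f i))" by auto
  then show ?thesis using max_mem uminus_mem assms by simp
qed

lemma module_axioms: "module real_ring E"
proof (rule moduleI)
  show "cring real_ring" by (rule cring_from_type_algebra)
  show "abelian_group E"
    by (rule abelian_groupI)
      (auto simp: zero_mem add_mem add_ac intro!: bexI[OF _ uminus_mem])
qed (auto simp: ring_of_type_algebra_def smult_mem algebra_simps)

lemma a_inv_eq [simp]: "f \<in> A \<Longrightarrow> \<ominus>\<^bsub>E\<^esub> f = (\<lambda>i. - f i)"
  using abelian_group.minus_equality[OF module.axioms(2)[OF module_axioms], of "\<lambda>i. - f i" f]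
  by (simp add: uminus_mem)

lemma a_minus_eq [simp]: "g \<in> A \<Longrightarrow> f \<ominus>\<^bsub>E\<^esub> g = (\<lambda>i. f i - g i)"
  by (simp add: a_minus_def)

section \<open>Lattice operations and disjointness computed pointwise\<close>

lemma is_lub_iff:
  "is_lub (order_of E) s B \<longleftrightarrow>
     s \<in> A \<and> (\<forall>f\<in>B \<inter> A. \<forall>i. f i \<le> s i) \<and>
     (\<forall>u\<in>A. (\<forall>f\<in>B \<inter> A. \<forall>i. f i \<le> u i) \<longrightarrow> (\<forall>i. s i \<le> u i))"
  by (auto simp: least_def Upper_def)

lemma is_glb_iff:
  "greatest (order_of E) s (Lower (order_of E) B) \<longleftrightarrow>
     s \<in> A \<and> (\<forall>f\<in>B \<inter> A. \<forall>i. s i \<le> f i) \<and>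
     (\<forall>u\<in>A. (\<forall>f\<in>B \<inter> A. \<forall>i. u i \<le> f i) \<longrightarrow> (\<forall>i. u i \<le> s i))"
  by (auto simp: greatest_def Lower_def)

lemma is_lub_max: "\<lbrakk>f \<in> A; g \<in> A\<rbrakk> \<Longrightarrow> is_lub (order_of E) (\<lambda>i. max (f i) (g i)) {f, g}"
  by (auto simp: is_lub_iff max_mem)

lemma is_glb_min:
  "\<lbrakk>f \<in> A; g \<in> A\<rbrakk> \<Longrightarrow>
     greatest (order_of E) (\<lambda>i. min (f i) (g i)) (Lower (order_of E) {f, g})"
  by (auto simp: is_glb_iff min_mem)

lemma lattice_axioms: "Lattice.lattice (order_of E)"
proof
  show "\<exists>s. is_lub (order_of E) s {f, g}"
    if "f \<in> carrier (order_of E)" "g \<in> carrier (order_of E)" for f g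
    using is_lub_max that by auto
  show "\<exists>s. greatest (order_of E) s (Lower (order_of E) {f, g})"
    if "f \<in> carrier (order_of E)" "g \<in> carrier (order_of E)" for f g
    using is_glb_min that by auto
qed (auto intro: order_trans order_antisym simp: fun_eq_iff)

lemma vsup_eq:
  assumes "f \<in> A" "g \<in> A"
  shows "vsup E f g = (\<lambda>i. max (f i) (g i))"
proof -
  interpret Lattice.lattice "order_of E" by (rule lattice_axioms)
  show ?thesis
    unfolding vsup_def join_def Lattice.sup_def
    by (rule some_equality) (use is_lub_max[OF assms] least_unique in blast)+
qed

lemma vinf_eq:
  assumes "f \<in> A" "g \<in> A"
  shows "vinf E f g = (\<lambda>i. min (f i) (g i))"
proof -
  interpret Lattice.lattice "order_of E" by (rule lattice_axioms)
  show ?thesis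
    unfolding vinf_def meet_def Lattice.inf_def
    by (rule some_equality) (use is_glb_min[OF assms] greatest_unique in blast)+
qed

lemma vabs_eq: "f \<in> A \<Longrightarrow> vabs E f = (\<lambda>i. \<bar>f i\<bar>)"
  by (auto simp: vabs_def vsup_eq uminus_mem fun_eq_iff)

lemma vdisjoint_iff:
  assumes "f \<in> A" "g \<in> A"
  shows "vdisjoint E f g \<longleftrightarrow> (\<forall>i. f i = 0 \<or> g i = 0)"
proof -
  have "min \<bar>a\<bar> \<bar>b\<bar> = 0 \<longleftrightarrow> a = 0 \<or> b = 0" for a b :: real by auto
  then show ?thesis
    using assms by (simp add: vdisjoint_def vabs_eq vinf_eq abs_mem fun_eq_iff)
qed

section \<open>The supremum norm\<close>

lemma vnorm_eq: "vnorm E f = (SUP i. \<bar>f i\<bar>)"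
  by (simp add: function_lattice_def)

lemma abs_le_vnorm:
  assumes "f \<in> A"
  shows "\<bar>f i\<bar> \<le> vnorm E f"
proof -
  have "bdd_above (range (\<lambda>i. \<bar>f i\<bar>))"
    using bounded[OF assms] by (auto simp: bounded_iff bdd_above_def)
  then show ?thesis
    unfolding vnorm_eq by (intro cSUP_upper) auto
qed

lemma vnorm_leI: "(\<And>i. \<bar>f i\<bar> \<le> c) \<Longrightarrow> vnorm E f \<le> c"
  unfolding vnorm_eq by (rule cSUP_least) auto

lemma vnorm_nonneg: "f \<in> A \<Longrightarrow> 0 \<le> vnorm E f"
  using abs_le_vnorm[of f undefined] by linarith

lemma vnorm_eq_zero: "f \<in> A \<Longrightarrow> vnorm E f = 0 \<longleftrightarrow> f = (\<lambda>i. 0)"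
  using abs_le_vnorm[of f] by (fastforce simp: vnorm_eq)

lemma vnorm_smult:
  assumes "f \<in> A"
  shows "vnorm E (\<lambda>i. a * f i) = \<bar>a\<bar> * vnorm E f"
proof (cases "a = 0")
  case False
  show ?thesis
  proof (rule antisym)
    show "vnorm E (\<lambda>i. a * f i) \<le> \<bar>a\<bar> * vnorm E f"
      by (intro vnorm_leI) (simp add: abs_mult mult_left_mono abs_le_vnorm assms)
    have "vnorm E f \<le> vnorm E (\<lambda>i. a * f i) / \<bar>a\<bar>"
      using abs_le_vnorm[OF smult_mem[OF assms], of a] False
      by (intro vnorm_leI) (simp add: field_simps abs_mult)
    then show "\<bar>a\<bar> * vnorm E f \<le> vnorm E (\<lambda>i. a * f i)"
      using False by (simp add: field_simps)
  qed
qed (simp add: vnorm_eq)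

lemma vnorm_triangle:
  assumes "f \<in> A" "g \<in> A"
  shows "vnorm E (\<lambda>i. f i + g i) \<le> vnorm E f + vnorm E g"
  using abs_le_vnorm assms by (intro vnorm_leI order_trans[OF abs_triangle_ineq] add_mono)

section \<open>The metric and its completeness\<close>

lemma vdist_eq: "\<lbrakk>f \<in> A; g \<in> A\<rbrakk> \<Longrightarrow> vdist E f g = vnorm E (\<lambda>i. f i - g i)"
  by (simp add: vdist_def)

lemma Metric_space_vdist: "Metric_space A (vdist E)"
proof
  show "0 \<le> vdist E f g" for f g
    by (simp add: vdist_def vnorm_nonneg diff_mem)
  show "vdist E f g = vdist E g f" for f g
    by (simp add: vdist_def vnorm_eq abs_minus_commute)
  show "vdist E f g = 0 \<longleftrightarrow> f = g" if "f \<in> A" "g \<in> A" for f g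
    using that by (simp add: vdist_eq vnorm_eq_zero diff_mem fun_eq_iff)
  show "vdist E f h \<le> vdist E f g + vdist E g h" if "f \<in> A" "g \<in> A" "h \<in> A" for f g h
    using vnorm_triangle[OF diff_mem diff_mem, of f g g h] that by (simp add: vdist_eq)
qed

text \<open>A Cauchy sequence for the norm is uniformly Cauchy, so it has a uniform limit, and
  \<open>A\<close> is closed under uniform limits.\<close>

lemma mcomplete_vdist: "Metric_space.mcomplete A (vdist E)"
proof -
  interpret Metric_space A "vdist E" by (rule Metric_space_vdist)
  show ?thesis
    unfolding mcomplete_def
  proof (intro allI impI)
    fix F assume F: "MCauchy F"
    then have mem: "F n \<in> A" for n by (auto simp: MCauchy_def)
    have "uniformly_Cauchy_on UNIV F"
    proof (rule uniformly_Cauchy_onI)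
      fix e :: real assume "0 < e"
      with F obtain N where N: "vdist E (F m) (F n) < e" if "N \<le> m" "N \<le> n" for m n
        unfolding MCauchy_def by blast
      have "dist (F m i) (F n i) < e" if "N \<le> m" "N \<le> n" for m n i
        using abs_le_vnorm[OF diff_mem[OF mem[of m] mem[of n]], of i] N[OF that]
        by (simp add: vdist_eq mem dist_real_def)
      then show "\<exists>M. \<forall>i\<in>UNIV. \<forall>m\<ge>M. \<forall>n\<ge>M. dist (F m i) (F n i) < e" by blast
    qed
    then obtain f where f: "uniform_limit UNIV F f sequentially"
      using Cauchy_uniformly_convergent uniformly_convergent_on_def by blast
    then have "f \<in> A" using uniform_limit_mem mem by blast
    have "\<exists>N. \<forall>n\<ge>N. vdist E (F n) f < e" if "0 < e" for e
    proof -
      \<comment> \<open>Passing to the supremum over \<open>i\<close> weakens \<open><\<close> to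
        \<open>\<le>\<close>; the half leaves room for the strict bound by \<open>e\<close>.\<close>
      obtain N where N: "dist (F n i) (f i) < e / 2" if "n \<ge> N" for n i
        using f \<open>0 < e\<close> unfolding uniform_limit_sequentially_iff by (meson UNIV_I half_gt_zero)
      have "vdist E (F n) f \<le> e / 2" if "n \<ge> N" for n
        unfolding vdist_eq[OF mem \<open>f \<in> A\<close>]
        using N[OF that] by (intro vnorm_leI) (simp add: dist_real_def less_imp_le)
      then show ?thesis using \<open>0 < e\<close>
        by (intro exI[of _ N]) (auto intro: le_less_trans[of _ "e / 2"])
    qed
    then show "\<exists>f. limitin mtopology F f sequentially"
      using mem \<open>f \<in> A\<close> by (auto simp: limit_metric_sequentially)
  qed
qed

lemma banach_lattice: "banach_lattice E"
proof (rule banach_lattice.intro)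
  show "vnorm E f \<le> vnorm E g"
    if "f \<in> carrier E" "g \<in> carrier E" "vabs E f \<preceq>\<^bsub>E\<^esub> vabs E g" for f g
    using that by (intro vnorm_leI) (auto simp: vabs_eq intro: order_trans abs_le_vnorm)
  show "Metric_space.mcomplete (carrier E) (vdist E)"
    using mcomplete_vdist by simp
  show "Lattice.lattice (order_of E)" by (rule lattice_axioms)
  show "module real_ring E" by (rule module_axioms)
qed (auto simp: vnorm_nonneg vnorm_eq_zero vnorm_smult vnorm_triangle mult_left_mono)

end

section \<open>The lattice of the counterexample\<close>

text \<open>Row \<open>n\<close>, column \<open>k\<close> of a grid, coded into \<open>nat\<close>
  so that functions on the grid have the type required by the theorem.\<close>

abbreviation cell :: "nat \<Rightarrow> nat \<Rightarrow> nat" where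
  "cell n k \<equiv> prod_encode (n, k)"

text \<open>Column 0 stores the limit of its row, enlarged by the factor \<open>n + 1\<close>. The
  condition is linear, and since the weight is positive it is also compatible with
  \<open>max\<close>.\<close>

definition weighted_rows :: "(nat \<Rightarrow> real) set" where
  "weighted_rows = {f. bounded (range f) \<and>
     (\<forall>n. (\<lambda>k. f (cell n (Suc k))) \<longlonglongrightarrow> f (cell n 0) / real (Suc n))}"

lemma weighted_rows_iff:
  "f \<in> weighted_rows \<longleftrightarrow> bounded (range f) \<and>
     (\<forall>n. (\<lambda>k. f (cell n (Suc k))) \<longlonglongrightarrow> f (cell n 0) / real (Suc n))"
  by (simp add: weighted_rows_def)

definition single_row :: "nat \<Rightarrow> (nat \<Rightarrow> real) \<Rightarrow> nat \<Rightarrow> real" where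
  "single_row n h i = (case prod_decode i of (m, k) \<Rightarrow> if m = n then h k else 0)"

lemma single_row_cell [simp]: "single_row n h (cell m k) = (if m = n then h k else 0)"
  by (simp add: single_row_def)

lemma cell_cases: "(\<And>m k. P (cell m k)) \<Longrightarrow> P i"
  by (metis prod_decode_inverse surj_pair)

lemma cell_ext: "(\<And>m k. f (cell m k) = g (cell m k)) \<Longrightarrow> f = g"
  using cell_cases[of "\<lambda>i. f i = g i"] by blast

text \<open>All other rows are zero and satisfy their limit condition trivially; boundedness comes
  from convergence of \<open>h\<close>, with 0 added for the values off the row.\<close>

lemma single_row_mem:
  assumes "(\<lambda>k. h (Suc k)) \<longlonglongrightarrow> h 0 / real (Suc n)"
  shows "single_row n h \<in> weighted_rows"
proof -
  have "bounded (range h)"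
    using assms by (metis LIMSEQ_imp_Suc convergentI convergent_imp_bounded)
  then have "bounded (insert 0 (range h))" by simp
  then have "bounded (range (single_row n h))"
    by (rule bounded_subset) (auto simp: single_row_def split: prod.split)
  then show ?thesis using assms by (auto simp: weighted_rows_iff)
qed

interpretation rows: closed_function_lattice weighted_rows
proof
  fix f g :: "nat \<Rightarrow> real" and a :: real
  assume f: "f \<in> weighted_rows"
  show "bounded (range f)" using f by (simp add: weighted_rows_iff)
  have "bounded (range (\<lambda>i. a * f i))"
    using f bounded_scaling[of "range f" a] by (simp add: weighted_rows_iff image_image)
  moreover have "(\<lambda>k. a * f (cell n (Suc k))) \<longlonglongrightarrow> a * f (cell n 0) / real (Suc n)" for n
    using f tendsto_mult_left[of _ "f (cell n 0) / real (Suc n)" sequentially a]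
    by (simp add: weighted_rows_iff)
  ultimately show "(\<lambda>i. a * f i) \<in> weighted_rows"
    by (simp add: weighted_rows_iff)
  assume g: "g \<in> weighted_rows"
  show "(\<lambda>i. f i + g i) \<in> weighted_rows"
    using f g by (auto simp: weighted_rows_iff add_divide_distrib intro: bounded_plus_comp tendsto_add)
  obtain B C where B: "\<And>i. \<bar>f i\<bar> \<le> B" and C: "\<And>i. \<bar>g i\<bar> \<le> C"
    using f g by (auto simp: weighted_rows_iff bounded_iff)
  have "\<bar>max (f i) (g i)\<bar> \<le> max B C" for i using B[of i] C[of i] by linarith
  \<comment> \<open>Positivity of the weight lets it pass through \<open>max\<close>, so the limit
    of the maximum is again the weighted entry of column 0.\<close>
  moreover have "max (f i) (g i) / c = max (f i / c) (g i / c)" if "c > 0" for i c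
    using that by (simp add: max_divide_distrib_right)
  ultimately show "(\<lambda>i. max (f i) (g i)) \<in> weighted_rows"
    using f g by (auto simp: weighted_rows_iff bounded_iff intro!: tendsto_max)
next
  show "(\<lambda>i. 0) \<in> weighted_rows" by (simp add: weighted_rows_iff)
next
  fix F and f :: "nat \<Rightarrow> real"
  assume F: "\<And>n. F n \<in> weighted_rows" and lim: "uniform_limit UNIV F f sequentially"
  have "bounded (range f)"
    using uniform_limit_bounded[OF lim] F by (auto simp: weighted_rows_iff)
  \<comment> \<open>Interchange of limits: along the row in \<open>k\<close>, and uniformly in
    \<open>m\<close>.\<close>
  moreover have "(\<lambda>k. f (cell n (Suc k))) \<longlonglongrightarrow> f (cell n 0) / real (Suc n)" for n
  proof (rule swap_uniform_limit'[where f = "\<lambda>m k. F m (cell n (Suc k))" and S = UNIV])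
    show "\<forall>\<^sub>F m in sequentially. (\<lambda>k. F m (cell n (Suc k))) \<longlonglongrightarrow> F m (cell n 0) / real (Suc n)"
      using F by (simp add: weighted_rows_iff)
    show "(\<lambda>m. F m (cell n 0) / real (Suc n)) \<longlonglongrightarrow> f (cell n 0) / real (Suc n)"
      using tendsto_uniform_limitI[OF lim] by (intro tendsto_divide) auto
    show "uniform_limit UNIV (\<lambda>m k. F m (cell n (Suc k))) (\<lambda>k. f (cell n (Suc k))) sequentially"
      using lim by (rule uniform_limit_compose') auto
  qed auto
  ultimately show "f \<in> weighted_rows" by (simp add: weighted_rows_iff)
qed

lemma vnorm_rows_leI: "(\<And>m k. \<bar>f (cell m k)\<bar> \<le> c) \<Longrightarrow> vnorm rows.E f \<le> c"
  using cell_cases[of "\<lambda>i. \<bar>f i\<bar> \<le> c"] by (intro rows.vnorm_leI) blast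

lemma row_tendsto:
  "f \<in> weighted_rows \<Longrightarrow> (\<lambda>k. f (cell n (Suc k))) \<longlonglongrightarrow> f (cell n 0) / real (Suc n)"
  by (simp add: weighted_rows_iff)


section \<open>The operators\<close>

text \<open>The factor 1/2 offsets the two terms in the difference and makes this a contraction. The
  0 in column 0 matches the row limit 0 of the image.\<close>

definition oscillation :: "nat \<Rightarrow> (nat \<Rightarrow> real) \<Rightarrow> nat \<Rightarrow> real" where
  "oscillation n f = single_row n
     (\<lambda>k. if k = 0 then 0 else (-1) ^ k / 2 * (f (cell n k) - f (cell n 0) / real (Suc n)))"

lemma oscillation_cell:
  "oscillation n f (cell m k) =
     (if m = n \<and> k \<noteq> 0 then (-1) ^ k / 2 * (f (cell n k) - f (cell n 0) / real (Suc n)) else 0)"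
  by (simp add: oscillation_def)

text \<open>The common source of the norm bound, of the estimate on disjoint elements and of the
  majorant for the \<epsilon>-center.\<close>

lemma abs_oscillation_le:
  "\<bar>oscillation n f (cell m k)\<bar> \<le>
     (if m = n \<and> k \<noteq> 0 then (\<bar>f (cell n k)\<bar> + \<bar>f (cell n 0)\<bar> / real (Suc n)) / 2 else 0)"
  using abs_triangle_ineq4[of "f (cell n k)" "f (cell n 0) / real (Suc n)"]
  by (simp add: oscillation_cell abs_mult power_abs)

lemma oscillation_mem:
  assumes "f \<in> weighted_rows"
  shows "oscillation n f \<in> weighted_rows"
proof -
  have "(\<lambda>k. f (cell n (Suc k)) - f (cell n 0) / real (Suc n)) \<longlonglongrightarrow> 0"
    using row_tendsto[OF assms] by (simp add: LIM_zero)
  \<comment> \<open>The sign has absolute value 1, so it cannot disturb convergence to 0.\<close>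
  then have "(\<lambda>k. (-1) ^ Suc k / 2 * (f (cell n (Suc k)) - f (cell n 0) / real (Suc n))) \<longlonglongrightarrow> 0"
    by (rule Lim_null_comparison[rotated, OF tendsto_norm_zero])
      (auto simp: abs_mult power_abs intro!: always_eventually)
  then show ?thesis
    unfolding oscillation_def by (intro single_row_mem) simp
qed

lemma linear_operator_oscillation: "linear_operator rows.E (oscillation n)"
  unfolding linear_operator_def
proof (intro conjI ballI allI)
  show "oscillation n \<in> carrier rows.E \<rightarrow> carrier rows.E"
    by (simp add: oscillation_mem)
  fix f g :: "nat \<Rightarrow> real" and a :: real
  have "c * (x + x' - (y + y') / d) = c * (x - y / d) + c * (x' - y' / d)" for c d x x' y y' :: real
    by (simp add: add_divide_distrib right_diff_distrib distrib_left)
  then show "oscillation n (f \<oplus>\<^bsub>rows.E\<^esub> g) = oscillation n f \<oplus>\<^bsub>rows.E\<^esub> oscillation n g"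
    unfolding rows.structure_simps
    by (intro cell_ext) (simp only: oscillation_cell if_True if_False add_0 split: if_split, blast)
  have "c * (a * x - a * y / d) = a * (c * (x - y / d))" for c d x y :: real
    by (simp add: right_diff_distrib mult.left_commute)
  then show "oscillation n (a \<odot>\<^bsub>rows.E\<^esub> f) = a \<odot>\<^bsub>rows.E\<^esub> oscillation n f"
    unfolding rows.structure_simps
    by (intro cell_ext) (simp only: oscillation_cell if_True if_False mult_zero_right split: if_split, blast)
qed

section \<open>Contraction, \<epsilon>-band preservation and membership in the
  \<epsilon>-center\<close>

lemma limit_le_vnorm:
  assumes "f \<in> weighted_rows"
  shows "\<bar>f (cell n 0)\<bar> / real (Suc n) \<le> vnorm rows.E f / real (Suc n)"
  using rows.abs_le_vnorm[OF assms] by (simp add: divide_right_mono)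

lemma vnorm_oscillation_le:
  assumes "f \<in> weighted_rows"
  shows "vnorm rows.E (oscillation n f) \<le> vnorm rows.E f"
proof (rule vnorm_rows_leI)
  fix m k
  have "vnorm rows.E f / real (Suc n) \<le> vnorm rows.E f"
    using rows.vnorm_nonneg[OF assms] by (simp add: field_simps)
  then show "\<bar>oscillation n f (cell m k)\<bar> \<le> vnorm rows.E f"
    using abs_oscillation_le[of n f m k] limit_le_vnorm[OF assms, of n]
      rows.abs_le_vnorm[OF assms, of "cell n k"] rows.vnorm_nonneg[OF assms]
    by (simp split: if_splits)
qed

lemma oscillation_bounded: "oscillation n \<in> bounded_operators rows.E"
  unfolding bounded_operators_def
  by (auto simp: linear_operator_oscillation vnorm_oscillation_le intro!: exI[of _ 1])

lemma opnorm_oscillation_le: "opnorm rows.E (oscillation n) \<le> 1"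
  unfolding opnorm_def
proof (rule cSUP_least)
  have "(\<lambda>i. 0) \<in> {x \<in> carrier rows.E. vnorm rows.E x \<le> 1}"
    by (auto simp: rows.zero_mem intro: rows.vnorm_leI)
  then show "{x \<in> carrier rows.E. vnorm rows.E x \<le> 1} \<noteq> {}" by blast
qed (auto intro: order_trans[OF vnorm_oscillation_le])

text \<open>At each cell either \<open>y\<close> vanishes, and so does the minimum, or
  \<open>f\<close> vanishes, and only half of the row limit survives; that is at most
  \<open>vnorm rows.E f / real (Suc n)\<close>.\<close>

lemma eps_band_preserving_oscillation:
  assumes "1 / real (Suc n) \<le> \<epsilon>"
  shows "eps_band_preserving rows.E \<epsilon> (oscillation n)"
  unfolding eps_band_preserving_def
proof (intro conjI ballI linear_operator_oscillation cSUP_least)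
  fix f assume "f \<in> carrier rows.E"
  then have f: "f \<in> weighted_rows" by simp
  have "(\<lambda>i. 0) \<in> {y \<in> carrier rows.E. \<zero>\<^bsub>rows.E\<^esub> \<preceq>\<^bsub>rows.E\<^esub> y \<and> vdisjoint rows.E y f}"
    using f by (simp add: rows.zero_mem rows.vdisjoint_iff)
  then show "{y \<in> carrier rows.E. \<zero>\<^bsub>rows.E\<^esub> \<preceq>\<^bsub>rows.E\<^esub> y \<and> vdisjoint rows.E y f} \<noteq> {}" by blast
  fix y assume "y \<in> {y \<in> carrier rows.E. \<zero>\<^bsub>rows.E\<^esub> \<preceq>\<^bsub>rows.E\<^esub> y \<and> vdisjoint rows.E y f}"
  then have y: "y \<in> weighted_rows" "\<And>i. 0 \<le> y i" and disj: "\<And>i. y i = 0 \<or> f i = 0"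
    using f by (auto simp: rows.vdisjoint_iff)
  have le: "vnorm rows.E f / real (Suc n) \<le> \<epsilon> * vnorm rows.E f" "0 \<le> vnorm rows.E f / real (Suc n)"
    using mult_right_mono[OF assms rows.vnorm_nonneg[OF f]] rows.vnorm_nonneg[OF f] by simp_all
  have "vnorm rows.E (\<lambda>i. min \<bar>oscillation n f i\<bar> (y i)) \<le> \<epsilon> * vnorm rows.E f"
  proof (rule vnorm_rows_leI)
    fix m k
    show "\<bar>min \<bar>oscillation n f (cell m k)\<bar> (y (cell m k))\<bar> \<le> \<epsilon> * vnorm rows.E f"
      using disj[of "cell m k"] abs_oscillation_le[of n f m k] limit_le_vnorm[OF f, of n]
        y(2)[of "cell m k"] le
      by (auto simp: min_def split: if_splits)
  qed
  then show "vnorm rows.E (vinf rows.E (vabs rows.E (oscillation n f)) y) \<le> \<epsilon> * vnorm rows.E f"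
    by (simp add: rows.vabs_eq rows.vinf_eq rows.abs_mem oscillation_mem f y)
qed

text \<open>With \<open>l\<close> the absolute value of the row limit,
  \<open>(\<bar>f\<bar> + l) / 2\<close> is at most the maximum of \<open>\<bar>f\<bar>\<close> and
  \<open>l\<close>, which is \<open>\<bar>f\<bar>\<close> plus the positive part of
  \<open>l - \<bar>f\<bar>\<close>. So the factor 1 suffices in front of
  \<open>\<bar>f\<bar>\<close>.\<close>

lemma oscillation_eps_center:
  assumes "1 / real (Suc n) \<le> \<epsilon>"
  shows "oscillation n \<in> eps_center rows.E \<epsilon>"
proof -
  have "\<exists>z\<in>weighted_rows. vnorm rows.E z \<le> \<epsilon> \<and> (\<forall>i. \<bar>oscillation n f i\<bar> \<le> 1 * \<bar>f i\<bar> + z i)"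
    if f: "f \<in> weighted_rows" and le1: "vnorm rows.E f \<le> 1" for f
  proof (intro bexI conjI)
    define l where "l = \<bar>f (cell n 0)\<bar> / real (Suc n)"
    \<comment> \<open>A row constantly \<open>l\<close> would need the entry
      \<open>(n + 1) * l\<close> in column 0, possibly larger than \<epsilon>. The positive part of
      \<open>l - \<bar>f\<bar>\<close> tends to 0 along the row, so column 0 may be 0.\<close>
    define z where "z = single_row n (\<lambda>k. if k = 0 then 0 else max 0 (l - \<bar>f (cell n k)\<bar>))"
    have "(\<lambda>k. max 0 (l - \<bar>f (cell n (Suc k))\<bar>)) \<longlonglongrightarrow> max 0 (l - \<bar>f (cell n 0) / real (Suc n)\<bar>)"
      by (intro tendsto_intros row_tendsto f)
    then show "z \<in> weighted_rows"
      unfolding z_def by (intro single_row_mem) (simp add: l_def)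
    have "l \<le> \<epsilon>"
      using limit_le_vnorm[OF f, of n] divide_right_mono[OF le1, of "real (Suc n)"] assms
      unfolding l_def by linarith
    moreover have "0 \<le> l" by (simp add: l_def)
    ultimately show "vnorm rows.E z \<le> \<epsilon>"
      by (intro vnorm_rows_leI) (auto simp: z_def)
    show "\<forall>i. \<bar>oscillation n f i\<bar> \<le> 1 * \<bar>f i\<bar> + z i"
    proof (intro allI, rule cell_cases)
      fix m k
      show "\<bar>oscillation n f (cell m k)\<bar> \<le> 1 * \<bar>f (cell m k)\<bar> + z (cell m k)"
        using abs_oscillation_le[of n f m k, folded l_def] by (auto simp: z_def split: if_splits)
    qed
  qed
  then show ?thesis
    unfolding eps_center_def
    by (auto simp: linear_operator_oscillation rows.vabs_eq oscillation_mem intro!: exI[of _ 1])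
qed


section \<open>Distance to the band preserving operators\<close>

text \<open>The column is \<open>Suc k\<close> because the indicator of a cell in column 0 violates
  the limit condition of its row.\<close>

definition atom :: "nat \<Rightarrow> nat \<Rightarrow> nat \<Rightarrow> real" where
  "atom n k = single_row n (\<lambda>j. if j = Suc k then 1 else 0)"

lemma atom_cell [simp]: "atom n k (cell m j) = (if m = n \<and> j = Suc k then 1 else 0)"
  by (simp add: atom_def)

lemma atom_mem: "atom n k \<in> weighted_rows"
proof -
  have "eventually (\<lambda>j. (if Suc j = Suc k then 1 else 0) = (0::real)) sequentially"
    using eventually_gt_at_top[of k] by eventually_elim simp
  then show ?thesis
    unfolding atom_def by (intro single_row_mem) (simp add: tendsto_eventually)
qed

text \<open>Since the atom at the cell belongs to the lattice, an upper bound can be lowered at this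
  cell alone. If all members of \<open>B\<close> vanish there, a supremum with a nonzero value
  \<open>c\<close> there would not be least.\<close>

lemma band_vanishing_at_cell: "band rows.E {f \<in> weighted_rows. f (cell n (Suc k)) = 0}"
  unfolding band_def order_ideal_def
proof (intro conjI allI impI ballI)
  show "submodule {f \<in> weighted_rows. f (cell n (Suc k)) = 0} real_ring rows.E"
    by (rule module.submoduleI[OF rows.module_axioms])
      (auto simp: rows.zero_mem rows.uminus_mem rows.add_mem rows.smult_mem)
next
  fix f g assume "f \<in> carrier rows.E" "g \<in> {f \<in> weighted_rows. f (cell n (Suc k)) = 0}"
    "vabs rows.E f \<preceq>\<^bsub>rows.E\<^esub> vabs rows.E g"
  then show "f \<in> {f \<in> weighted_rows. f (cell n (Suc k)) = 0}"
    by (auto simp: rows.vabs_eq) (metis abs_le_zero_iff abs_zero)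
next
  fix B s assume *: "B \<subseteq> {f \<in> weighted_rows. f (cell n (Suc k)) = 0} \<and> is_lub (order_of rows.E) s B"
  then have s: "s \<in> weighted_rows" and ub: "\<And>f i. f \<in> B \<Longrightarrow> f i \<le> s i"
    and least: "\<And>u. u \<in> weighted_rows \<Longrightarrow> (\<And>f i. f \<in> B \<Longrightarrow> f i \<le> u i) \<Longrightarrow> \<forall>i. s i \<le> u i"
    unfolding rows.is_lub_iff by blast+
  define c where "c = s (cell n (Suc k))"
  define u where "u = (\<lambda>i. s i - \<bar>c\<bar> * atom n k i)"
  \<comment> \<open>The absolute value also covers \<open>B = {}\<close>, where \<open>c\<close> need not be nonnegative.\<close>
  have "u \<in> weighted_rows"
    unfolding u_def by (intro rows.diff_mem rows.smult_mem s atom_mem)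
  moreover have "f i \<le> u i" if "f \<in> B" for f i
  proof (rule cell_cases)
    fix m j
    show "f (cell m j) \<le> u (cell m j)"
      using * that ub[OF that, of "cell m j"] by (auto simp: u_def c_def)
  qed
  ultimately have "s (cell n (Suc k)) \<le> u (cell n (Suc k))" using least by blast
  then show "s \<in> {f \<in> weighted_rows. f (cell n (Suc k)) = 0}"
    using s by (simp add: u_def c_def)
qed

text \<open>\<open>opnorm\<close> is a supremum of reals and dominates its members only if they are
  bounded above; boundedness of \<open>T\<close> and \<open>S\<close> supplies this.\<close>

lemma abs_le_opnorm_op_diff:
  assumes T: "T \<in> bounded_operators rows.E" and S: "S \<in> bounded_operators rows.E"
    and f: "f \<in> weighted_rows" "vnorm rows.E f \<le> 1"
  shows "\<bar>T f i - S f i\<bar> \<le> opnorm rows.E (op_diff rows.E T S)"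
proof -
  have mem: "T g \<in> weighted_rows" "S g \<in> weighted_rows" if "g \<in> weighted_rows" for g
    using T S that by (auto simp: bounded_operators_def linear_operator_def)
  obtain C D where C: "\<And>g. g \<in> weighted_rows \<Longrightarrow> vnorm rows.E (T g) \<le> C * vnorm rows.E g"
    and D: "\<And>g. g \<in> weighted_rows \<Longrightarrow> vnorm rows.E (S g) \<le> D * vnorm rows.E g"
    using T S by (auto simp: bounded_operators_def)
  have "vnorm rows.E (op_diff rows.E T S g) \<le> \<bar>C\<bar> + \<bar>D\<bar>"
    if g: "g \<in> weighted_rows" "vnorm rows.E g \<le> 1" for g
  proof (rule rows.vnorm_leI)
    fix j
    \<comment> \<open>The constants \<open>C\<close> and \<open>D\<close> may be negative, hence the
      absolute values.\<close>
    have "c * vnorm rows.E g \<le> \<bar>c\<bar>" for c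
      using mult_mono[of c "\<bar>c\<bar>" "vnorm rows.E g" 1] g rows.vnorm_nonneg[OF g(1)] by simp
    then have "vnorm rows.E (T g) \<le> \<bar>C\<bar>" "vnorm rows.E (S g) \<le> \<bar>D\<bar>"
      using order_trans[OF C[OF g(1)]] order_trans[OF D[OF g(1)]] by blast+
    then show "\<bar>op_diff rows.E T S g j\<bar> \<le> \<bar>C\<bar> + \<bar>D\<bar>"
      using rows.abs_le_vnorm[OF mem(1)[OF g(1)], of j] rows.abs_le_vnorm[OF mem(2)[OF g(1)], of j]
      by (simp add: op_diff_def mem g)
  qed
  then have "bdd_above ((\<lambda>g. vnorm rows.E (op_diff rows.E T S g)) `
      {g \<in> carrier rows.E. vnorm rows.E g \<le> 1})"
    by (intro bdd_aboveI2[where M = "\<bar>C\<bar> + \<bar>D\<bar>"]) simp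
  then have "vnorm rows.E (op_diff rows.E T S f) \<le> opnorm rows.E (op_diff rows.E T S)"
    unfolding opnorm_def by (rule cSUP_upper[rotated]) (simp add: f)
  moreover have "\<bar>T f i - S f i\<bar> \<le> vnorm rows.E (op_diff rows.E T S f)"
    using rows.abs_le_vnorm[OF rows.diff_mem[OF mem[OF f(1)]], of i]
    by (simp add: op_diff_def mem f)
  ultimately show ?thesis by linarith
qed

text \<open>One function \<open>u\<close>, equal to 1 on row \<open>n\<close> beyond column 0,
  serves all \<open>k\<close>: \<open>u\<close> minus the atom lies in the band of functions
  vanishing at the cell, so \<open>S u\<close> and the image of the atom agree there. The values of
  \<open>S u\<close> along the row converge.\<close>

lemma band_preserving_diagonal_convergent:
  assumes "band_preserving rows.E S"
  shows "convergent (\<lambda>k. S (atom n k) (cell n (Suc k)))"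
proof -
  \<comment> \<open>The entry \<open>Suc n\<close> in column 0, divided by the weight, is the row
    limit 1.\<close>
  define u where "u = single_row n (\<lambda>k. if k = 0 then real (Suc n) else 1)"
  have u: "u \<in> weighted_rows"
    unfolding u_def by (intro single_row_mem) simp
  have S: "S \<in> weighted_rows \<rightarrow> weighted_rows"
    "\<And>f g. \<lbrakk>f \<in> weighted_rows; g \<in> weighted_rows\<rbrakk> \<Longrightarrow>
      S (\<lambda>i. f i + g i) = (\<lambda>i. S f i + S g i)"
    using assms by (auto simp: band_preserving_def linear_operator_def)
  have "S (atom n k) (cell n (Suc k)) = S u (cell n (Suc k))" for k
  proof -
    let ?v = "\<lambda>i. u i - atom n k i"
    have "?v \<in> {f \<in> weighted_rows. f (cell n (Suc k)) = 0}"
      using u atom_mem by (simp add: rows.diff_mem u_def)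
    then have "S ?v \<in> {f \<in> weighted_rows. f (cell n (Suc k)) = 0}"
      using assms band_vanishing_at_cell unfolding band_preserving_def by blast
    then show ?thesis
      using S(2)[OF rows.diff_mem[OF u atom_mem] atom_mem, of n k n k] by (simp add: fun_eq_iff)
  qed
  moreover have "S u \<in> weighted_rows" using S u by blast
  ultimately show ?thesis
    using row_tendsto convergentI by fastforce
qed

text \<open>The diagonal of \<open>S\<close> has a limit \<open>l\<close>, while that of the
  oscillation alternates between 1/2 and -1/2. Hence both \<open>1/2 - l\<close> and
  \<open>1/2 + l\<close> are at most the norm, and their average is 1/2.\<close>

lemma opnorm_oscillation_diff_ge:
  assumes S: "S \<in> bounded_operators rows.E" "band_preserving rows.E S"
  shows "1 / 2 \<le> opnorm rows.E (op_diff rows.E (oscillation n) S)" (is "_ \<le> ?M")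
proof -
  obtain l where l: "(\<lambda>k. S (atom n k) (cell n (Suc k))) \<longlonglongrightarrow> l" (is "?s \<longlonglongrightarrow> _")
    using band_preserving_diagonal_convergent[OF S(2)] unfolding convergent_def by blast
  \<comment> \<open>An atom is 0 in column 0, so no limit is subtracted and its multiplier is
    exactly the signed half.\<close>
  have *: "\<bar>(-1) ^ Suc k / 2 - ?s k\<bar> \<le> ?M" for k
  proof -
    have "vnorm rows.E (atom n k) \<le> 1" by (rule vnorm_rows_leI) simp
    from abs_le_opnorm_op_diff[OF oscillation_bounded S(1) atom_mem this, of n "cell n (Suc k)"]
    show ?thesis by (simp add: oscillation_cell)
  qed
  \<comment> \<open>The atom with index \<open>k\<close> sits in column \<open>Suc k\<close>, so odd
    \<open>k\<close> gives the sign +1 and even \<open>k\<close> the sign -1.\<close>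
  have "1 / 2 - l \<le> ?M"
  proof (rule LIMSEQ_le_const2)
    show "(\<lambda>k. 1 / 2 - ?s (2 * k + 1)) \<longlonglongrightarrow> 1 / 2 - l"
      using LIMSEQ_subseq_LIMSEQ[OF l, of "\<lambda>k. 2 * k + 1"]
      by (intro tendsto_diff) (auto simp: strict_mono_def o_def)
    have "1 / 2 - ?s (2 * k + 1) \<le> ?M" for k
      using *[of "2 * k + 1"] by (simp add: abs_le_iff)
    then show "\<exists>N. \<forall>k\<ge>N. 1 / 2 - ?s (2 * k + 1) \<le> ?M" by blast
  qed
  moreover have "1 / 2 + l \<le> ?M"
  proof (rule LIMSEQ_le_const2)
    show "(\<lambda>k. 1 / 2 + ?s (2 * k)) \<longlonglongrightarrow> 1 / 2 + l"
      using LIMSEQ_subseq_LIMSEQ[OF l, of "\<lambda>k. 2 * k"]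
      by (intro tendsto_add) (auto simp: strict_mono_def o_def)
    have "1 / 2 + ?s (2 * k) \<le> ?M" for k
      using *[of "2 * k"] by (simp add: abs_le_iff)
    then show "\<exists>N. \<forall>k\<ge>N. 1 / 2 + ?s (2 * k) \<le> ?M" by blast
  qed
  ultimately show ?thesis by linarith
qed

theorem proposition7p1:
  shows "\<exists>E :: (nat \<Rightarrow> real) normed_riesz. banach_lattice E \<and>
    (\<forall>\<epsilon>>0. \<exists>T \<in> bounded_operators E.
       opnorm E T \<le> 1 \<and>
       eps_band_preserving E \<epsilon> T \<and>
       T \<in> eps_center E \<epsilon> \<and>
       (\<forall>S \<in> bounded_operators E. band_preserving E S \<longrightarrow> opnorm E (op_diff E T S) \<ge> 1 / 2))"
proof (intro exI[of _ rows.E] conjI allI impI rows.banach_lattice)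
  fix \<epsilon> :: real assume "0 < \<epsilon>"
  \<comment> \<open>The lattice is already fixed; only the row on which the operator acts depends on
    \<epsilon>.\<close>
  then obtain n where "1 / real (Suc n) \<le> \<epsilon>"
    using nat_approx_posE less_imp_le by metis
  then show "\<exists>T \<in> bounded_operators rows.E.
       opnorm rows.E T \<le> 1 \<and> eps_band_preserving rows.E \<epsilon> T \<and> T \<in> eps_center rows.E \<epsilon> \<and>
       (\<forall>S \<in> bounded_operators rows.E. band_preserving rows.E S \<longrightarrow>
          opnorm rows.E (op_diff rows.E T S) \<ge> 1 / 2)"
    using oscillation_bounded opnorm_oscillation_le eps_band_preserving_oscillation
      oscillation_eps_center opnorm_oscillation_diff_ge
    by (intro bexI[of _ "oscillation n"]) auto
qed

end
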